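(* For each $n\ge 0$ let $Q_n(s)$ be the coefficient of $u^n/n!$ in the Taylor expansion (in $u$) of $$H(s)=\frac{u-1}{s e^{us}-s^2e^{u}}-\frac{1}{2s\sqrt{s}}\left(\frac{e^{u\sqrt{s}}}{\sqrt{s}+1}+\frac{e^{-u\sqrt{s}}}{\sqrt{s}-1}\right),$$ that is, $$H(s)=\frac{u^3}{3!}+(s+3)\frac{u^4}{4!}+(s^2+17s+4)\frac{u^5}{5!}+(s^3+46s^2+80s+5)\frac{u^6}{6!}+\cdots+Q_n(s)\frac{u^n}{n!}+\cdots.$$ Then the coefficients $Q_n(s)$ are polynomials in $s$ with nonnegative integer coefficients.
   Context: $H(s)$ is regarded as a power series in $u$ whose coefficients are a priori rational functions of $\sqrt{s}$. *)

theory Defs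
  imports "HOL-Computational_Algebra.Computational_Algebra"
begin

text \<open>
  The coefficient field \<open>\<rat>(\<surd>s)\<close> is the field of rational functions over the rationals in
  one indeterminate, namely \<open>\<surd>s\<close>; accordingly \<open>s\<close> is the square of that indeterminate.
  The power series variable \<open>u\<close> is \<^const>\<open>fps_X\<close>, and \<open>e\<^sup>a\<^sup>u\<close> is \<open>fps_exp a\<close>.
\<close>

type_synonym ratfun = "rat poly fract"

definition sqrt_s :: ratfun where
  "sqrt_s = Fract [:0, 1:] 1"

definition s :: ratfun where
  "s = sqrt_s ^ 2"

text \<open>
  The constant term of the first denominator is \<open>s - s\<^sup>2 \<noteq> 0\<close>, so it is a unit and
  \<open>/\<close> on power series is division by a unit.
\<close>

definition H :: "ratfun fps" where
  "H = (fps_X - 1) / (fps_const s * fps_exp s - fps_const (s ^ 2) * fps_exp 1)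
     - fps_const (1 / (2 * s * sqrt_s)) *
         (fps_exp sqrt_s / fps_const (sqrt_s + 1) + fps_exp (- sqrt_s) / fps_const (sqrt_s - 1))"

definition Q :: "nat \<Rightarrow> ratfun" where
  "Q n = fact n * fps_nth H n"

end

theory Submission
  imports Defs
begin

text \<open>
  Since \<open>\<surd>s\<close> enters only through \<open>C = cosh (u\<surd>s) - sinh (u\<surd>s) / \<surd>s\<close>, one has
  \<open>s (s - 1) H = (1 - u) D - C\<close>, where \<open>D = (s - 1) / (s e\<^sup>u - e\<^sup>u\<^sup>s)\<close> is the exponential
  generating function of the derangement polynomials \<open>d\<^sub>n\<close> (derangements counted by excedances).
  The equation \<open>(1 - s u) D\<^sub>u = s u D + s (1 - s) D\<^sub>s\<close> is the recurrence of the \<open>d\<^sub>n\<close>;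
  rewritten for \<open>H\<close> it becomes, for \<open>n \<ge> 1\<close>,
  \<open>Q\<^bsub>n+1\<^esub> = (1 + (n - 3) s) Q\<^sub>n + s (1 - s) Q\<^sub>n' + n s Q\<^bsub>n-1\<^esub> + d\<^sub>n / s + \<lfloor>(n - 1) / 2\<rfloor> s\<^bsup>\<lfloor>n/2\<rfloor> - 1\<^esup>\<close>.
  The coefficient of \<open>s\<^sup>k\<close> in the first two summands is
  \<open>(k + 1) q\<^sub>k + (n - 2 - k) q\<^bsub>k-1\<^esub>\<close>, with \<open>q\<^sub>i\<close> the coefficients of \<open>Q\<^sub>n\<close>, and
  \<open>deg Q\<^sub>n \<le> n - 3\<close> excludes negative contributions.
\<close>

section \<open>Polynomial families and their recurrences\<close>

definition pX :: "'a::comm_ring_1 poly" where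
  "pX = [:0, 1:]"

lemma coeff_pX_mult: "coeff (pX * p) k = (if k = 0 then 0 else coeff p (k - 1))"
  by (cases k) (auto simp: pX_def)

lemma coeff_pX_power: "coeff (pX ^ m) k = (if k = m then 1 else 0)"
  using coeff_monom[of "1::'a::comm_ring_1" m k] by (simp add: monom_altdef pX_def)

lemma pderiv_pX [simp]: "pderiv pX = 1"
  by (simp add: pX_def pderiv_pCons)

lemma poly_pX [simp]: "poly pX x = x"
  by (simp add: pX_def)

text \<open>The derangement polynomials \<open>d_n\<close>. The coefficient ring stays generic
  because they are later taken with coefficients in \<open>ratfun\<close> and evaluated at
  \<open>s\<close>.\<close>

fun der_poly :: "nat \<Rightarrow> 'a::idom poly" where
  "der_poly 0 = 1"
| "der_poly (Suc 0) = 0"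
| "der_poly (Suc (Suc n)) = of_nat (Suc n) * (pX * (der_poly (Suc n) + der_poly n))
     + pX * ((1 - pX) * pderiv (der_poly (Suc n)))"

text \<open>The coefficients of \<open>cosh (u\<surd>s) - sinh (u\<surd>s) / \<surd>s\<close>.\<close>

definition cosh_poly :: "nat \<Rightarrow> 'a::idom poly" where
  "cosh_poly n = (- 1) ^ n * pX ^ (n div 2)"

text \<open>Here \<open>poly_shift 1\<close> is exact division by the indeterminate, as
  \<open>der_poly (Suc n)\<close> has no constant term. The exponent in the last summand is
  truncated only for \<open>n = 0\<close>, where the factor \<open>n div 2\<close> is zero.\<close>

fun Q_poly :: "nat \<Rightarrow> 'a::idom poly" where
  "Q_poly 0 = 0"
| "Q_poly (Suc 0) = 0"
| "Q_poly (Suc (Suc n)) = Q_poly (Suc n) + (of_nat n - 2) * (pX * Q_poly (Suc n))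
     + pX * ((1 - pX) * pderiv (Q_poly (Suc n))) + of_nat (Suc n) * (pX * Q_poly n)
     + poly_shift 1 (der_poly (Suc n)) + of_nat (n div 2) * pX ^ (Suc n div 2 - 1)"

section \<open>Coefficient recurrences, degree bounds and nonnegativity\<close>

lemma coeff_of_nat_mult: "coeff (of_nat m * p) k = of_nat m * coeff p k"
  by (simp add: of_nat_poly)

lemma coeff_euler_operator:
  "coeff (pX * ((1 - pX) * pderiv p)) k
     = of_nat k * coeff p k - (if k = 0 then 0 else (of_nat k - 1) * coeff p (k - 1))"
  by (cases k) (auto simp: coeff_pderiv coeff_pX_mult left_diff_distrib)

lemma coeff_der_poly_0: "n > 0 \<Longrightarrow> coeff (der_poly n) 0 = 0"
  by (induction n rule: der_poly.induct) (simp_all add: coeff_of_nat_mult coeff_pX_mult del: of_nat_Suc)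

lemma coeff_der_poly_rec:
  "coeff (der_poly (Suc (Suc n)) :: 'a::idom poly) (Suc k) =
     of_nat (Suc k) * coeff (der_poly (Suc n)) (Suc k)
     + (of_nat (Suc n) - of_nat k) * coeff (der_poly (Suc n)) k
     + of_nat (Suc n) * coeff (der_poly n) k"
  unfolding der_poly.simps coeff_add coeff_of_nat_mult coeff_euler_operator
  unfolding coeff_pX_mult
  by (simp add: algebra_simps)

text \<open>Degree below \<open>n\<close> for positive \<open>n\<close>; the condition
  \<open>k > 0\<close> excludes only the constant term of \<open>der_poly 0 = 1\<close>.\<close>

lemma coeff_der_poly_eq_0: "k \<ge> n \<Longrightarrow> k > 0 \<Longrightarrow> coeff (der_poly n) k = 0"
proof (induction n arbitrary: k rule: der_poly.induct)
  case (3 n)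
  then obtain j where "k = Suc j" by (cases k) auto
  with 3 show ?case by (simp add: coeff_der_poly_rec del: der_poly.simps)
qed auto

text \<open>One formula also covers \<open>n = 0\<close>: the factor \<open>of_nat n\<close> cancels
  the truncated index, and the derivative of the constant 1 vanishes.\<close>

lemma der_poly_Suc:
  "der_poly (Suc n) = of_nat n * (pX * (der_poly n + der_poly (n - 1)))
     + pX * ((1 - pX) * pderiv (der_poly n))"
  by (cases n) simp_all

text \<open>For use with \<open>x\<close> a coefficient that a degree bound makes zero as soon as
  the factor would be negative.\<close>

lemma Nats_diff_mult: "(k > n \<Longrightarrow> x = 0) \<Longrightarrow> x \<in> \<nat> \<Longrightarrow> (of_nat n - of_nat k) * x \<in> \<nat>"
  for x :: "'a::idom"
  by (cases "k \<le> n") (auto simp flip: of_nat_diff)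

lemma coeff_der_poly_Nats: "coeff (der_poly n :: 'a::idom poly) k \<in> \<nat>"
proof (induction n arbitrary: k rule: der_poly.induct)
  case (3 n)
  show ?case
  proof (cases k)
    case 0
    then show ?thesis by (simp only: coeff_der_poly_0) simp
  next
    case (Suc j)
    have "(of_nat (Suc n) - of_nat j) * coeff (der_poly (Suc n) :: 'a poly) j \<in> \<nat>"
      by (rule Nats_diff_mult) (auto intro: 3 coeff_der_poly_eq_0)
    with 3 show ?thesis
      unfolding Suc coeff_der_poly_rec by (intro Nats_add Nats_mult[OF of_nat_in_Nats])
  qed
qed (auto simp: coeff_1)

lemma coeff_Q_poly_rec:
  "coeff (Q_poly (Suc (Suc n)) :: 'a::idom poly) k =
     of_nat (Suc k) * coeff (Q_poly (Suc n)) k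
     + (if k = 0 then 0 else (of_nat n - of_nat (Suc k)) * coeff (Q_poly (Suc n)) (k - 1)
         + of_nat (Suc n) * coeff (Q_poly n) (k - 1))
     + coeff (der_poly (Suc n)) (Suc k)
     + (if k = Suc n div 2 - 1 then of_nat (n div 2) else 0)"
proof -
  have diff: "coeff ((of_nat n - 2) * p) k = (of_nat n - 2) * coeff p k" for p :: "'a poly"
    using coeff_of_nat_mult[of n p k] coeff_of_nat_mult[of 2 p k]
    by (simp add: left_diff_distrib)
  show ?thesis
    unfolding Q_poly.simps coeff_add coeff_of_nat_mult diff coeff_euler_operator
      coeff_poly_shift coeff_pX_power
    unfolding coeff_pX_mult
    by (simp add: algebra_simps)
qed

lemma coeff_Q_poly_eq_0: "k + 3 > n \<Longrightarrow> coeff (Q_poly n) k = 0"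
proof (induction n arbitrary: k rule: Q_poly.induct)
  case (3 n)
  \<comment> \<open>Beyond the degree bound \<open>k\<close> is at least \<open>n\<close>, which
    exceeds the exponent of the explicit power unless \<open>n = 0\<close>.\<close>
  then have "k \<noteq> Suc n div 2 - 1 \<or> n div 2 = 0" by auto
  with 3 show ?case
    by (auto simp: coeff_Q_poly_rec coeff_der_poly_eq_0 simp del: der_poly.simps Q_poly.simps)
qed auto

lemma coeff_Q_poly_Nats: "coeff (Q_poly n :: 'a::idom poly) k \<in> \<nat>"
proof (induction n arbitrary: k rule: Q_poly.induct)
  case (3 n)
  \<comment> \<open>If \<open>Suc k > n\<close>, then \<open>k - 1 + 3 > Suc n\<close>, so the
    degree bound for \<open>Q_poly (Suc n)\<close> makes this coefficient zero.\<close>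
  have "(of_nat n - of_nat (Suc k)) * coeff (Q_poly (Suc n) :: 'a poly) (k - 1) \<in> \<nat>"
    by (rule Nats_diff_mult) (auto intro: 3 coeff_Q_poly_eq_0)
  with 3 show ?case
    unfolding coeff_Q_poly_rec
    by (intro Nats_add Nats_mult[OF of_nat_in_Nats] coeff_der_poly_Nats)
      (auto intro!: Nats_add Nats_mult[OF of_nat_in_Nats] simp del: of_nat_Suc)
qed auto

section \<open>Closed relation between the three families\<close>

lemma pX_shift_der_poly: "n > 0 \<Longrightarrow> pX * poly_shift 1 (der_poly n) = der_poly n"
  by (rule poly_eqI) (auto simp: coeff_pX_mult coeff_poly_shift coeff_der_poly_0)

lemma pX_pderiv_power: "pX * pderiv (pX ^ m) = (of_nat m * pX ^ m :: 'a::idom poly)"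
  by (cases m) (simp_all add: pderiv_power of_nat_poly algebra_simps del: power_Suc, simp)

text \<open>The contribution of the cosh terms to the recurrence for \<open>Q_poly\<close>. Each
  \<open>cosh_poly\<close> is a signed power, on which the Euler operator multiplies by the
  exponent; splitting by parity collapses the combination to a single power.\<close>

lemma cosh_poly_rec:
  "pX * (pX - 1) * (of_nat (n div 2) * pX ^ (Suc n div 2 - 1)) =
     of_nat n * pX * cosh_poly (Suc n) + of_nat (Suc n) * pX * cosh_poly n
     - cosh_poly (Suc (Suc n)) - pX * (pX - 1) * pderiv (cosh_poly (Suc n) :: 'a::idom poly)"
proof (cases "even n")
  case True
  then obtain m where n: "n = 2 * m" by blast
  have *: "cosh_poly n = (pX ^ m :: 'a poly)" "cosh_poly (Suc n) = - (pX ^ m :: 'a poly)"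
    "cosh_poly (Suc (Suc n)) = (pX ^ Suc m :: 'a poly)"
    unfolding n cosh_poly_def by auto
  have div: "n div 2 = m" "Suc n div 2 = m"
    by (simp_all add: n)
  have 1: "pX * (pX - 1) * (of_nat m * pX ^ (m - 1)) = (pX - 1) * (of_nat m * pX ^ m :: 'a poly)"
    by (cases m) (simp_all add: algebra_simps)
  have 2: "pX * (pX - 1) * pderiv (- (pX ^ m)) = - ((pX - 1) * (of_nat m * pX ^ m :: 'a poly))"
    by (simp add: pX_pderiv_power[symmetric] pderiv_minus algebra_simps)
  show ?thesis
    unfolding * div 1 2 by (simp add: n algebra_simps)
next
  case False
  then obtain m where n: "n = Suc (2 * m)" using oddE by fastforce
  have *: "cosh_poly n = - (pX ^ m :: 'a poly)" "cosh_poly (Suc n) = (pX ^ Suc m :: 'a poly)"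
    "cosh_poly (Suc (Suc n)) = - (pX ^ Suc m :: 'a poly)"
    unfolding n cosh_poly_def by auto
  have "pX * (pX - 1) * pderiv (pX ^ Suc m) = (pX - 1) * (of_nat (Suc m) * pX ^ Suc m :: 'a poly)"
    by (simp only: pX_pderiv_power[symmetric] mult_ac)
  then show ?thesis
    unfolding * by (simp add: n algebra_simps)
qed

text \<open>Coefficient form of \<open>s (s - 1) H = (1 - u) D - C\<close>. Induction along the
  recurrence, with the derivative of the previous instance supplying the term
  \<open>pderiv (Q_poly (Suc n))\<close>.\<close>

lemma Q_poly_eq:
  "pX * (pX - 1) * Q_poly n = der_poly n - of_nat n * der_poly (n - 1) - (cosh_poly n :: 'a::idom poly)"
proof (induction n rule: Q_poly.induct)
  case (3 n)
  define X where "X = (pX :: 'a poly)"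
  define q0 where "q0 = (Q_poly n :: 'a poly)"
  define q1 where "q1 = (Q_poly (Suc n) :: 'a poly)"
  define c0 where "c0 = (cosh_poly n :: 'a poly)"
  define c1 where "c1 = (cosh_poly (Suc n) :: 'a poly)"
  define d0 where "d0 = (der_poly n :: 'a poly)"
  define d1 where "d1 = (der_poly (Suc n) :: 'a poly)"
  define e where "e = (of_nat n * der_poly (n - 1) :: 'a poly)"
  define N where "N = (of_nat n :: 'a poly)"
  have q0: "X * (X - 1) * q0 = d0 - e - c0"
    using 3 by (simp add: X_def q0_def d0_def e_def c0_def)
  have q1: "X * (X - 1) * q1 = d1 - (N + 1) * d0 - c1"
    using 3 by (simp add: X_def q1_def d1_def d0_def N_def c1_def)
  have "pderiv (of_nat m :: 'a poly) = 0" for m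
    by (simp add: of_nat_poly)
  then have q1': "(2 * X - 1) * q1 + X * (X - 1) * pderiv q1
      = pderiv d1 - (N + 1) * pderiv d0 - pderiv c1"
    using arg_cong[OF q1, of pderiv]
    by (simp add: pderiv_mult pderiv_diff pderiv_add X_def N_def algebra_simps)
  have d1: "d1 = X * (N * d0 + e) + X * ((1 - X) * pderiv d0)"
    unfolding d1_def d0_def e_def N_def X_def by (subst der_poly_Suc) (simp add: algebra_simps)
  have c: "X * (X - 1) * (of_nat (n div 2) * X ^ (Suc n div 2 - 1)) =
     N * X * c1 + (N + 1) * X * c0 - cosh_poly (Suc (Suc n)) - X * (X - 1) * pderiv c1"
    using cosh_poly_rec[of n] by (simp add: X_def c0_def c1_def N_def algebra_simps)
  have e1: "X * poly_shift 1 d1 = d1"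
    unfolding X_def d1_def by (rule pX_shift_der_poly) simp
  have Q2: "Q_poly (Suc (Suc n)) = q1 + (N - 2) * (X * q1)
     + X * ((1 - X) * pderiv q1) + (N + 1) * (X * q0)
     + poly_shift 1 d1 + of_nat (n div 2) * X ^ (Suc n div 2 - 1)"
    by (simp add: X_def q0_def q1_def d1_def N_def algebra_simps)
  have d2: "der_poly (Suc (Suc n)) = (N + 1) * (X * (d1 + d0)) + X * ((1 - X) * pderiv d1)"
    by (simp add: X_def d0_def d1_def N_def algebra_simps)
  \<comment> \<open>Grouped so that the left sides of \<open>q1\<close>, \<open>q1'\<close>,
    \<open>q0\<close>, \<open>e1\<close> and \<open>c\<close> appear as factors and can be
    replaced.\<close>
  have "X * (X - 1) * Q_poly (Suc (Suc n)) =
      N * X * (X * (X - 1) * q1) - X * (X - 1) * ((2 * X - 1) * q1 + X * (X - 1) * pderiv q1)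
      + (N + 1) * X * (X * (X - 1) * q0) + (X - 1) * (X * poly_shift 1 d1)
      + X * (X - 1) * (of_nat (n div 2) * X ^ (Suc n div 2 - 1))"
    unfolding Q2 by algebra
  also have "\<dots> = N * X * (d1 - (N + 1) * d0) - X * (X - 1) * (pderiv d1 - (N + 1) * pderiv d0)
      + (N + 1) * X * (d0 - e) + (X - 1) * d1 - cosh_poly (Suc (Suc n))"
    unfolding q0 q1 q1' e1 c by algebra
  \<comment> \<open>The terms in \<open>e\<close> and \<open>pderiv d0\<close>, both multiplied by
    \<open>N + 1\<close>, are eliminated by the recurrence \<open>d1\<close>.\<close>
  also have "\<dots> = der_poly (Suc (Suc n)) - (N + 2) * d1 - cosh_poly (Suc (Suc n))"
    unfolding d2 using d1 by algebra
  finally have "X * (X - 1) * Q_poly (Suc (Suc n)) = \<dots>" .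
  then show ?case
    by (simp add: X_def N_def d1_def algebra_simps)
qed (auto simp: cosh_poly_def)

section \<open>Generating functions over polynomials, differentiated in \<open>u\<close> by
  \<open>fps_deriv\<close> and in \<open>s\<close> by \<open>fps_pderiv\<close>\<close>

definition fps_pderiv :: "'a::idom poly fps \<Rightarrow> 'a poly fps" where
  "fps_pderiv F = Abs_fps (\<lambda>n. pderiv (fps_nth F n))"

lemma fps_nth_pderiv [simp]: "fps_nth (fps_pderiv F) n = pderiv (fps_nth F n)"
  by (simp add: fps_pderiv_def)

lemma fps_pderiv_mult: "fps_pderiv (F * G) = F * fps_pderiv G + fps_pderiv F * G"
proof -
  have "pderiv (sum f A) = (\<Sum>i\<in>A. pderiv (f i))" for f :: "nat \<Rightarrow> 'a poly" and A
    by (induction A rule: infinite_finite_induct) (simp_all add: pderiv_add)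
  then show ?thesis
    by (intro fps_ext) (simp add: fps_mult_nth pderiv_mult sum.distrib
      mult.commute[of _ "pderiv (fps_nth F _)"])
qed

definition egf :: "(nat \<Rightarrow> 'a::field_char_0 poly) \<Rightarrow> 'a poly fps" where
  "egf f = Abs_fps (\<lambda>n. smult (1 / fact n) (f n))"

lemma egf_add: "egf f + egf g = egf (\<lambda>n. f n + g n)"
  and egf_diff: "egf f - egf g = egf (\<lambda>n. f n - g n)"
  and egf_const: "fps_const p * egf f = egf (\<lambda>n. p * f n)"
  and egf_pderiv: "fps_pderiv (egf f) = egf (\<lambda>n. pderiv (f n))"
  by (simp_all add: egf_def fps_eq_iff smult_add_right smult_diff_right pderiv_smult)

lemma egf_deriv: "fps_deriv (egf f) = egf (\<lambda>n. f (Suc n))"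
  and egf_X: "fps_X * egf f = egf (\<lambda>n. of_nat n * f (n - 1))"
proof -
  have *: "of_nat (Suc n) * smult (1 / fact (Suc n)) p = smult (1 / fact n) p" for n and p :: "'a poly"
  proof -
    have "of_nat (Suc n) * (1 / fact (Suc n)) = (1 / fact n :: 'a)"
      by (simp del: of_nat_Suc)
    then show ?thesis
      by (simp add: of_nat_poly del: of_nat_Suc fact_Suc)
  qed
  show "fps_deriv (egf f) = egf (\<lambda>n. f (Suc n))"
    using * by (simp add: egf_def fps_eq_iff del: of_nat_Suc fact_Suc)
  show "fps_X * egf f = egf (\<lambda>n. of_nat n * f (n - 1))"
  proof (rule fps_ext)
    fix n
    show "fps_nth (fps_X * egf f) n = fps_nth (egf (\<lambda>n. of_nat n * f (n - 1))) n"
      using *[of "n - 1" "f (n - 1)"]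
      by (cases n) (simp_all add: egf_def del: of_nat_Suc fact_Suc)
  qed
qed

lemma egf_der_poly_pde:
  fixes D X :: "'a::field_char_0 poly fps"
  defines "D \<equiv> egf der_poly" and "X \<equiv> fps_const pX"
  shows "(1 - X * fps_X) * fps_deriv D = X * fps_X * D + X * (1 - X) * fps_pderiv D"
proof -
  have C: "1 - X = fps_const (1 - pX)" by (simp add: X_def)
  \<comment> \<open>The equation solved for the plain derivative, so that both sides are an
    \<open>egf\<close> and termwise comparison gives \<open>der_poly_Suc\<close>.\<close>
  have "fps_deriv D = X * (fps_X * (fps_deriv D + D) + (1 - X) * fps_pderiv D)"
    unfolding C unfolding X_def D_def egf_deriv egf_pderiv egf_add egf_X egf_const
  proof (rule arg_cong[where f = egf], rule ext)
    fix n
    show "der_poly (Suc n) = pX * (of_nat n * (der_poly (Suc (n - 1)) + der_poly (n - 1)) +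
            (1 - pX) * pderiv (der_poly n :: 'a poly))"
      by (subst der_poly_Suc, cases n) (simp_all add: algebra_simps)
  qed
  then show ?thesis by algebra
qed

text \<open>\<open>W\<close> is \<open>s e^u - e^(us)\<close>. Its zero-order factor
  \<open>s (1 - u)\<close> complements the \<open>s u\<close> of \<open>egf_der_poly_pde\<close>:
  the product rule gives \<open>D * W\<close> the factor \<open>s\<close>.\<close>

lemma egf_exp_pde:
  fixes W X :: "'a::field_char_0 poly fps"
  defines "W \<equiv> egf (\<lambda>n. pX - pX ^ n)" and "X \<equiv> fps_const pX"
  shows "(1 - X * fps_X) * fps_deriv W = X * (1 - fps_X) * W + X * (1 - X) * fps_pderiv W"
proof -
  have C: "1 - X = fps_const (1 - pX)" by (simp add: X_def)
  have "fps_deriv W = X * (fps_X * (fps_deriv W - W) + (W + (1 - X) * fps_pderiv W))"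
    unfolding C unfolding X_def W_def egf_deriv egf_pderiv egf_add egf_diff egf_X egf_const egf_add
  proof (rule arg_cong[where f = egf], rule ext)
    fix n
    show "pX - pX ^ Suc n = pX * (of_nat n * ((pX - pX ^ Suc (n - 1)) - (pX - pX ^ (n - 1)))
            + ((pX - pX ^ n) + (1 - pX) * pderiv (pX - pX ^ n :: 'a poly)))"
    proof (cases n)
      case (Suc k)
      have "(1 - pX) * (pX * pderiv (pX ^ n)) = (1 - pX) * (of_nat n * pX ^ n :: 'a poly)"
        by (simp only: pX_pderiv_power)
      with Suc show ?thesis
        by (simp add: pderiv_diff algebra_simps del: power_Suc) (simp add: algebra_simps)
    qed (auto simp: pderiv_diff algebra_simps)
  qed
  then show ?thesis by algebra
qed

text \<open>Both sides solve \<open>(1 - s u) P_u = s P + s (1 - s) P_s\<close> with the same value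
  at \<open>u = 0\<close>. The equation determines each coefficient in \<open>u\<close> from the
  preceding one, so the difference vanishes.\<close>

lemma egf_der_poly_mult:
  "egf der_poly * egf (\<lambda>n. pX - pX ^ n) = (fps_const (pX - 1) :: 'a::field_char_0 poly fps)"
proof -
  define D W X :: "'a poly fps"
    where "D = egf der_poly" and "W = egf (\<lambda>n. pX - pX ^ n)" and "X = fps_const pX"
  define P where "P = D * W - (X - 1)"
  have P: "fps_deriv P = X * (fps_X * fps_deriv P + P + (1 - X) * fps_pderiv P)"
  proof -
    have "fps_deriv X = 0" "fps_pderiv X = 1"
      by (auto simp: X_def fps_eq_iff)
    moreover have "fps_deriv P = D * fps_deriv W + fps_deriv D * W - fps_deriv X"
      by (simp add: P_def)
    moreover have "fps_pderiv P = D * fps_pderiv W + fps_pderiv D * W - fps_pderiv X"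
      by (simp add: P_def fps_pderiv_mult[symmetric] fps_eq_iff pderiv_diff pderiv_add)
    ultimately show ?thesis
      using P_def egf_der_poly_pde[where 'a = 'a, folded D_def X_def]
        egf_exp_pde[where 'a = 'a, folded W_def X_def] by algebra
  qed
  have "fps_nth P n = 0" for n
  proof (induction n)
    case 0
    then show ?case by (simp add: P_def D_def W_def X_def egf_def)
  next
    case (Suc n)
    have C: "1 - X = fps_const (1 - pX)" by (simp add: X_def)
    have "of_nat (Suc n) * fps_nth P (Suc n) = fps_nth (X * (fps_X * fps_deriv P + P + (1 - X) * fps_pderiv P)) n"
      by (subst P[symmetric]) simp
    \<comment> \<open>Coefficient \<open>n\<close> of the right side involves only
      \<open>fps_nth P n\<close> and its derivative, since \<open>fps_X * fps_deriv P\<close>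
      contributes \<open>n\<close> times it.\<close>
    also have "\<dots> = 0"
      using Suc unfolding C unfolding X_def by (cases n) simp_all
    finally show ?case by (simp del: of_nat_Suc)
  qed
  then have "P = 0" by (intro fps_ext) simp
  then show ?thesis by (simp add: P_def D_def W_def X_def)
qed


section \<open>Evaluation in the coefficient field and identification of \<open>Q n\<close>\<close>

lemma der_poly_fps:
  fixes x :: "'a::field_char_0"
  shows "Abs_fps (\<lambda>n. poly (der_poly n) x / fact n) * (fps_const x * fps_exp 1 - fps_exp x) = fps_const (x - 1)"
proof (rule fps_ext)
  fix n
  \<comment> \<open>Evaluation at \<open>x\<close> is a ring homomorphism, so it carries the product
    over polynomials to the field coefficient by coefficient.\<close>
  have "fps_nth (Abs_fps (\<lambda>n. poly (der_poly n) x / fact n) * (fps_const x * fps_exp 1 - fps_exp x)) n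
     = poly (fps_nth (egf (der_poly :: nat \<Rightarrow> 'a poly) * egf (\<lambda>n. pX - pX ^ n)) n) x"
    unfolding fps_mult_nth[of "Abs_fps _"] fps_mult_nth[of "egf _"] poly_sum
    by (simp add: egf_def diff_divide_distrib right_diff_distrib mult.commute)
  also have "\<dots> = fps_nth (fps_const (x - 1)) n"
    unfolding egf_der_poly_mult by (cases n) simp_all
  finally show "fps_nth (Abs_fps (\<lambda>n. poly (der_poly n) x / fact n) * (fps_const x * fps_exp 1 - fps_exp x)) n
    = fps_nth (fps_const (x - 1)) n" .
qed

text \<open>Over the common denominator \<open>(y + 1) * (y - 1) = x - 1\<close> the numerator is
  \<open>2 * y ^ (n + 1)\<close> for even \<open>n\<close> and \<open>- 2 * y ^ n\<close> for odd
  \<open>n\<close>; removing \<open>2 * y\<close> leaves an even power of \<open>y\<close>.\<close>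

lemma poly_cosh_poly:
  fixes x y :: "'a::field_char_0"
  assumes "y ^ 2 = x" "x \<noteq> 0" "x \<noteq> 1"
  shows "1 / (2 * x * y) * (y ^ n / (y + 1) + (- y) ^ n / (y - 1)) = poly (cosh_poly n) x / (x * (x - 1))"
proof -
  have nz: "y \<noteq> 0" "y + 1 \<noteq> 0" "y - 1 \<noteq> 0" "x - 1 \<noteq> 0"
    using assms by (auto simp: eq_neg_iff_add_eq_0[symmetric])
  have x: "(y + 1) * (y - 1) = x - 1"
    using assms(1) by (simp add: power2_eq_square algebra_simps)
  have "y ^ n / (y + 1) + (- y) ^ n / (y - 1) = (y ^ n * (y - 1) + (- y) ^ n * (y + 1)) / (x - 1)"
    using nz unfolding x[symmetric] by (simp add: divide_simps mult.commute)
  also have "y ^ n * (y - 1) + (- y) ^ n * (y + 1) = 2 * y * poly (cosh_poly n) x"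
    by (cases "even n")
      (auto simp: cosh_poly_def assms(1)[symmetric] algebra_simps power_mult[symmetric] elim!: evenE oddE)
  finally show ?thesis using nz assms(2) by simp
qed

lemma Q_eq: "Q n = poly (Q_poly n) s"
proof -
  have s0: "s \<noteq> 0" "s \<noteq> 1"
    by (auto simp: s_def sqrt_s_def power2_eq_square eq_fract Zero_fract_def One_fract_def one_pCons)
  have y0: "sqrt_s \<noteq> 0" "sqrt_s + 1 \<noteq> 0" "sqrt_s - 1 \<noteq> 0"
    by (auto simp: sqrt_s_def eq_fract Zero_fract_def One_fract_def one_pCons)
  define d where "d = Abs_fps (\<lambda>n. poly (der_poly n) s / fact n)"
  define W where "W = fps_const s * fps_exp s - fps_const (s ^ 2) * fps_exp 1"
  have W0: "fps_nth W 0 \<noteq> 0"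
    using s0 by (simp add: W_def power2_eq_square)
  \<comment> \<open>Exposes the factor of \<open>der_poly_fps\<close>, making \<open>d\<close> an
    inverse of \<open>W\<close> up to a constant.\<close>
  have "W = - (fps_const s * (fps_const s * fps_exp 1 - fps_exp s))"
    by (simp add: W_def power2_eq_square algebra_simps flip: fps_const_mult)
  then have "d * W = - (fps_const s * (d * (fps_const s * fps_exp 1 - fps_exp s)))"
    by (simp only: mult_minus_right mult_ac)
  also have "\<dots> = fps_const (- (s * (s - 1)))"
    unfolding d_def der_poly_fps by simp
  finally have dW: "d * W = fps_const (- (s * (s - 1)))" .
  have "(fps_X - 1) / W = (1 - fps_X) * d * fps_const (1 / (s * (s - 1)))"
  proof -
    have "(1 - fps_X) * d * fps_const (1 / (s * (s - 1))) * W = (1 - fps_X) * fps_const (1 / (s * (s - 1))) * (d * W)"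
      by (simp add: mult_ac)
    also have "\<dots> = fps_X - 1"
      using s0 unfolding dW mult.assoc fps_const_mult by simp
    finally have "fps_X - 1 = (1 - fps_X) * d * fps_const (1 / (s * (s - 1))) * W" ..
    moreover have "W \<noteq> 0" using W0 by auto
    ultimately show ?thesis by (metis nonzero_mult_div_cancel_right)
  qed
  then have H: "H = (1 - fps_X) * d * fps_const (1 / (s * (s - 1)))
     - fps_const (1 / (2 * s * sqrt_s)) *
         (fps_exp sqrt_s * fps_const (1 / (sqrt_s + 1)) + fps_exp (- sqrt_s) * fps_const (1 / (sqrt_s - 1)))"
    unfolding H_def W_def using y0 by (simp add: fps_divide_unit fps_const_inverse inverse_eq_divide)
  have d_nth: "fps_nth ((1 - fps_X) * d) n = poly (der_poly n - of_nat n * der_poly (n - 1)) s / fact n"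
    by (cases n) (simp_all add: d_def left_diff_distrib diff_divide_distrib del: of_nat_Suc)
  have fact_mult: "fact n * (r / fact n * a - c * (p / fact n * b + q / fact n * e)) = r * a - c * (p * b + q * e)"
    for a b c e p q r :: ratfun
    by (simp add: field_simps)
  have "Q n = poly (der_poly n - of_nat n * der_poly (n - 1)) s / (s * (s - 1))
      - 1 / (2 * s * sqrt_s) * (sqrt_s ^ n / (sqrt_s + 1) + (- sqrt_s) ^ n / (sqrt_s - 1))"
    unfolding Q_def H fps_sub_nth fps_mult_right_const_nth fps_mult_left_const_nth fps_add_nth
      d_nth fps_exp_nth of_nat_fact fact_mult by simp
  also have "1 / (2 * s * sqrt_s) * (sqrt_s ^ n / (sqrt_s + 1) + (- sqrt_s) ^ n / (sqrt_s - 1))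
      = poly (cosh_poly n) s / (s * (s - 1))"
    using s0 by (intro poly_cosh_poly) (simp_all add: s_def)
  also have "poly (der_poly n - of_nat n * der_poly (n - 1)) s / (s * (s - 1)) - \<dots>
      = poly (pX * (pX - 1) * Q_poly n) s / (s * (s - 1))"
    unfolding Q_poly_eq by (simp add: diff_divide_distrib)
  also have "\<dots> = poly (Q_poly n) s"
    using s0 by simp
  finally show ?thesis .
qed

section \<open>Initial values and passage to integer polynomials\<close>

lemma Q_poly_values:
  fixes q :: "nat \<Rightarrow> 'a::idom poly"
  defines "q \<equiv> Q_poly"
  shows "q 2 = 0" "q 3 = 1" "q 4 = [:3, 1:]" "q 5 = [:4, 17, 1:]" "q 6 = [:5, 80, 46, 1:]"
proof -
  have shift: "poly_shift (Suc 0) (pCons a p) = p" for a and p :: "'a poly"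
    by (rule poly_eqI) (simp add: coeff_poly_shift)
  note eval = shift pX_def pderiv_pCons one_pCons of_nat_poly numeral_poly
  have 2: "(2::nat) = Suc (Suc 0)" and 3: "(3::nat) = Suc (Suc (Suc 0))"
    and 4: "(4::nat) = Suc (Suc (Suc (Suc 0)))" and 5: "(5::nat) = Suc (Suc (Suc (Suc (Suc 0))))"
    and 6: "(6::nat) = Suc (Suc (Suc (Suc (Suc (Suc 0)))))" by simp_all
  show "q 2 = 0" unfolding q_def 2 by (simp add: eval)
  show "q 3 = 1" unfolding q_def 3 by (simp add: eval)
  show "q 4 = [:3, 1:]" unfolding q_def 4 by (simp add: eval)
  show "q 5 = [:4, 17, 1:]" unfolding q_def 5 by (simp add: eval)
  show "q 6 = [:5, 80, 46, 1:]" unfolding q_def 6 by (simp add: eval)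
qed

lemma Nats_poly_eq_of_int_poly:
  fixes q :: "'a::comm_ring_1 poly"
  assumes "\<And>i. coeff q i \<in> \<nat>"
  obtains p :: "int poly" where "\<And>i. 0 \<le> coeff p i" "q = map_poly of_int p"
proof -
  \<comment> \<open>\<open>SOME\<close> picks a natural preimage. The value at 0 is fixed separately
    because \<open>coeff_map_poly\<close> requires \<open>g 0 = 0\<close>, which the choice alone
    would not ensure in positive characteristic.\<close>
  define g where "g = (\<lambda>c::'a. if c = 0 then 0 else int (SOME k. of_nat k = c))"
  have g: "of_int (g c) = c" if "c \<in> \<nat>" for c
    using that someI_ex[of "\<lambda>k. of_nat k = c"] by (auto simp: g_def Nats_def)
  have "coeff (map_poly g q) i = g (coeff q i)" for i
    by (simp add: coeff_map_poly g_def)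
  moreover have "g c \<ge> 0" for c
    by (simp add: g_def)
  ultimately show ?thesis
    using assms by (intro that[of "map_poly g q"]) (auto intro: poly_eqI simp: coeff_map_poly g)
qed

theorem corollary19:
  shows "(Q 0 = 0 \<and> Q 1 = 0 \<and> Q 2 = 0 \<and> Q 3 = 1 \<and> Q 4 = s + 3 \<and> Q 5 = s ^ 2 + 17 * s + 4 \<and>
          Q 6 = s ^ 3 + 46 * s ^ 2 + 80 * s + 5) \<and>
         (\<forall>n. \<exists>p :: int poly. (\<forall>i. 0 \<le> coeff p i) \<and> Q n = poly (map_poly of_int p) s)"
proof (intro conjI allI)
  fix n
  obtain p :: "int poly" where "\<And>i. 0 \<le> coeff p i" "(Q_poly n :: ratfun poly) = map_poly of_int p"
    using Nats_poly_eq_of_int_poly[of "Q_poly n :: ratfun poly"] coeff_Q_poly_Nats by blast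
  then show "\<exists>p :: int poly. (\<forall>i. 0 \<le> coeff p i) \<and> Q n = poly (map_poly of_int p) s"
    using Q_eq[of n] by auto
qed (simp_all add: Q_eq Q_poly_values algebra_simps power2_eq_square power3_eq_cube)

end
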